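(* Let $m,n\ge 0$ and $p\ge 1$ be integers, let $d_1,\dots,d_p$ be positive real numbers, and put $d_{p+1}:=1$. Define $$D_p(z)=\sum_{k=0}^{p} d_{p+1-k}\,\bigl(z^{2k}+z^{4p-2k}\bigr)$$ and $$E_p(z)=\Bigl(\sum_{j=1}^{p+1} d_j\Bigr)z^{2p}+\sum_{i=1}^{p}2^{2i-1}z^{2(p-i)}\sum_{j=1}^{p-i+1}\frac{j+i-1}{i}\binom{j+2i-2}{j-1}d_{j+i}.$$ For integers $n$, write $$N_{n,p}:=\int_0^\infty\frac{z^{2n}\,dz}{\bigl(D_p(z)\bigr)^{m+1}}.$$ Then for $0\le n\le (m+1)p-1$, $$N_{n,p}=2^{-m}\sum_{j=0}^{(m+1)p-n-1}4^{j}\binom{(m+1)p-n-1+j}{2j}\int_0^\infty\frac{z^{2((m+1)p-1-j)}}{\bigl(E_p(z)\bigr)^{m+1}}\,dz,$$ and for $(m+1)p-1<n<2p(m+1)-1$, $$N_{n,p}=N_{2p(m+1)-1-n,\,p}.$$ *)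

theory Defs
  imports "HOL-Analysis.Analysis"
begin

text \<open>
  The coefficients are a function \<open>d\<close> on the natural numbers, of which only the values at
  \<open>1, \<dots>, p + 1\<close> are used.  All natural-number subtractions in the summation ranges below
  are exact.
\<close>

definition D :: "nat \<Rightarrow> (nat \<Rightarrow> real) \<Rightarrow> real \<Rightarrow> real" where
  "D p d z = (\<Sum>k=0..p. d (p + 1 - k) * (z ^ (2 * k) + z ^ (4 * p - 2 * k)))"

definition E :: "nat \<Rightarrow> (nat \<Rightarrow> real) \<Rightarrow> real \<Rightarrow> real" where
  "E p d z =
     (\<Sum>j=1..p + 1. d j) * z ^ (2 * p) +
     (\<Sum>i=1..p. 2 ^ (2 * i - 1) * z ^ (2 * (p - i)) *
        (\<Sum>j=1..p - i + 1.
           real (j + i - 1) / real i * real ((j + 2 * i - 2) choose (j - 1)) * d (j + i)))"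

definition N_integrand :: "nat \<Rightarrow> nat \<Rightarrow> (nat \<Rightarrow> real) \<Rightarrow> nat \<Rightarrow> real \<Rightarrow> real" where
  "N_integrand m p d n z = z ^ (2 * n) / D p d z ^ (m + 1)"

definition E_integrand :: "nat \<Rightarrow> nat \<Rightarrow> (nat \<Rightarrow> real) \<Rightarrow> nat \<Rightarrow> real \<Rightarrow> real" where
  "E_integrand m p d j z = z ^ (2 * ((m + 1) * p - 1 - j)) / E p d z ^ (m + 1)"

definition N :: "nat \<Rightarrow> nat \<Rightarrow> (nat \<Rightarrow> real) \<Rightarrow> nat \<Rightarrow> real" where
  "N m p d n = (LBINT z=0..\<infinity>. N_integrand m p d n z)"

text \<open>
  The library integral of a non-integrable function is \<open>0\<close>, so convergence is not implied by
  an equation between integrals and has to be stated separately.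
\<close>

abbreviation converges_0_inf :: "(real \<Rightarrow> real) \<Rightarrow> bool" where
  "converges_0_inf f \<equiv> interval_lebesgue_integrable lborel 0 \<infinity> f"

end

theory Submission
  imports Defs "HOL-Probability.Sinc_Integral"
begin

text \<open>
  Put \<open>u = exp t\<close> and \<open>1 / z = sinh t = (u - 1 / u) / 2\<close>, so that \<open>z = 2 * u / (u\<^sup>2 - 1)\<close> maps
  \<open>u > 1\<close> onto \<open>z > 0\<close>. As \<open>D\<close> is palindromic, \<open>D(u) / u^(2p)\<close> is a combination of the
  \<open>2 * cosh (2 q t)\<close>, and expanding these in powers of \<open>sinh t\<close> gives
  \<open>D(u) / u^(2p) = 2 * E(z) / z^(2p)\<close>. The inversion \<open>u \<mapsto> 1 / u\<close> folds the integral of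
  \<open>u^(2n) / D(u)^(m+1)\<close> onto \<open>u > 1\<close>; this yields the symmetry in \<open>n\<close>, and the numerator becomes
  a multiple of \<open>cosh ((2 r + 1) t)\<close> with \<open>r = (m+1) p - n - 1\<close>. The expansion of
  \<open>cosh ((2 r + 1) t) / cosh t\<close> in powers of \<open>sinh t\<close> provides the sum over \<open>j\<close>.
\<close>

section \<open>Expansion of hyperbolic functions of multiple arguments in powers of
  \<open>sinh t\<close>\<close>

text \<open>
  With \<open>w = (2 * sinh t)\<^sup>2\<close>, the two polynomials below are \<open>cosh ((2 r + 1) t) / cosh t\<close> and
  \<open>sinh ((2 r + 2) t) / sinh (2 t)\<close>; Pascal's rule gives a joint recursion for them.
\<close>

definition cheb :: "nat \<Rightarrow> real \<Rightarrow> real" where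
  "cheb r w = (\<Sum>j=0..r. real ((r + j) choose (2 * j)) * w ^ j)"

definition cheb' :: "nat \<Rightarrow> real \<Rightarrow> real" where
  "cheb' r w = (\<Sum>j=0..r. real ((r + j + 1) choose (2 * j + 1)) * w ^ j)"

text \<open>Pascal's rule in the coefficients. Multiplied by \<open>cosh t\<close>, this is
  cosh((2r+3)t) - cosh((2r+1)t) = 2 sinh((2r+2)t) sinh t.\<close>

lemma cheb_Suc: "cheb (Suc r) w = cheb r w + w * cheb' r w"
proof -
  have "cheb (Suc r) w = 1 + (\<Sum>j=0..r. real ((r + j + 2) choose (2 * j + 2)) * w ^ (j + 1))"
    unfolding cheb_def by (subst sum.atLeast0_atMost_Suc_shift) (simp add: o_def)
  also have "\<dots> = 1 + (\<Sum>j=0..r. real ((r + j + 1) choose (2 * j + 2)) * w ^ (j + 1)) + w * cheb' r w"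
    by (simp add: cheb'_def sum_distrib_left algebra_simps flip: sum.distrib)
  also have "1 + (\<Sum>j=0..r. real ((r + j + 1) choose (2 * j + 2)) * w ^ (j + 1))
      = (\<Sum>j=0..Suc r. real ((r + j) choose (2 * j)) * w ^ j)"
    by (subst sum.atLeast0_atMost_Suc_shift) (simp add: o_def binomial_eq_0)
  also have "\<dots> = cheb r w" by (simp add: cheb_def binomial_eq_0)
  finally show ?thesis .
qed

text \<open>Pascal's rule again; multiplied by \<open>sinh (2 t)\<close>, this is sinh((2r+4)t) -
  sinh((2r+2)t) = 2 cosh((2r+3)t) sinh t.\<close>

lemma cheb'_Suc: "cheb' (Suc r) w = cheb' r w + cheb (Suc r) w"
proof -
  have "cheb' (Suc r) w = (\<Sum>j=0..Suc r. real ((r + j + 1) choose (2 * j + 1)) * w ^ j) + cheb (Suc r) w"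
    by (simp add: cheb'_def cheb_def algebra_simps del: sum.cl_ivl_Suc flip: sum.distrib)
  also have "(\<Sum>j=0..Suc r. real ((r + j + 1) choose (2 * j + 1)) * w ^ j) = cheb' r w"
    by (simp add: cheb'_def binomial_eq_0)
  finally show ?thesis .
qed

text \<open>Here u = exp t and v = exp(-t), so \<open>(u - v)\<^sup>2\<close> is \<open>w\<close>.
  The two claims share one induction because the recursions for \<open>cheb\<close> and
  \<open>cheb'\<close> are coupled.\<close>

lemma cheb_hyperbolic:
  fixes u v :: real
  assumes "u * v = 1"
  shows "(u + v) * cheb r ((u - v)\<^sup>2) = u ^ (2 * r + 1) + v ^ (2 * r + 1)"
    and "(u\<^sup>2 - v\<^sup>2) * cheb' r ((u - v)\<^sup>2) = u ^ (2 * r + 2) - v ^ (2 * r + 2)"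
proof (induction r)
  case 0
  show "(u + v) * cheb 0 ((u - v)\<^sup>2) = u ^ (2 * 0 + 1) + v ^ (2 * 0 + 1)"
    and "(u\<^sup>2 - v\<^sup>2) * cheb' 0 ((u - v)\<^sup>2) = u ^ (2 * 0 + 2) - v ^ (2 * 0 + 2)"
    by (simp_all add: cheb_def cheb'_def power2_eq_square)
next
  case (Suc r)
  define a b where "a = u ^ (2 * r + 1)" and "b = v ^ (2 * r + 1)"
  have IH1: "(u + v) * cheb r ((u - v)\<^sup>2) = a + b"
    and IH2: "(u\<^sup>2 - v\<^sup>2) * cheb' r ((u - v)\<^sup>2) = u * a - v * b"
    using Suc by (simp_all add: a_def b_def)
  have "(u + v) * cheb (Suc r) ((u - v)\<^sup>2)
      = a + b + (u - v) * (u * a - v * b)"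
    unfolding cheb_Suc using IH1 IH2 by algebra
  also have "\<dots> = u\<^sup>2 * a + v\<^sup>2 * b"
    using assms by algebra
  finally have 1: "(u + v) * cheb (Suc r) ((u - v)\<^sup>2) = u\<^sup>2 * a + v\<^sup>2 * b" .
  then show "(u + v) * cheb (Suc r) ((u - v)\<^sup>2) = u ^ (2 * Suc r + 1) + v ^ (2 * Suc r + 1)"
    by (simp add: a_def b_def power2_eq_square)
  have "(u\<^sup>2 - v\<^sup>2) * cheb' (Suc r) ((u - v)\<^sup>2) = u * a - v * b + (u - v) * (u\<^sup>2 * a + v\<^sup>2 * b)"
    unfolding cheb'_Suc using 1 IH2 by algebra
  also have "\<dots> = u ^ 3 * a - v ^ 3 * b"
    using assms by algebra
  finally show "(u\<^sup>2 - v\<^sup>2) * cheb' (Suc r) ((u - v)\<^sup>2) = u ^ (2 * Suc r + 2) - v ^ (2 * Suc r + 2)"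
    by (simp add: a_def b_def power2_eq_square power3_eq_cube)
qed

text \<open>With B = C(q+i-1, 2i-1), Pascal's rule turns the left side into B + 2 C(q+i-1, 2i), and
  absorption gives 2i C(q+i-1, 2i) = (q-i) B. The total is B q/i.\<close>

lemma binomial_add_shift:
  assumes "1 \<le> i" "i \<le> q"
  shows "real ((q + i) choose (2 * i)) + real ((q + i - 1) choose (2 * i))
    = real q / real i * real ((q + i - 1) choose (q - i))"
proof -
  have sym: "(q + i - 1) choose (q - i) = (q + i - 1) choose (2 * i - 1)"
    using assms by (subst binomial_symmetric) auto
  have pascal: "(q + i) choose (2 * i) = ((q + i - 1) choose (2 * i - 1)) + ((q + i - 1) choose (2 * i))"
    using assms by (subst choose_reduce_nat) auto
  have "2 * i * ((q + i - 1) choose (2 * i)) = (q - i) * ((q + i - 1) choose (2 * i - 1))"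
    using binomial_absorb_comp[of "q + i - 1" "2 * i - 1"] binomial_absorption[of "2 * i - 1" "q + i - 1"] assms
    by simp
  then have "2 * real i * real ((q + i - 1) choose (2 * i)) = real (q - i) * real ((q + i - 1) choose (2 * i - 1))"
    by (metis of_nat_mult of_nat_numeral)
  then show ?thesis
    using assms unfolding sym pascal by (simp add: field_simps of_nat_diff)
qed

text \<open>From 2 cosh t cosh(2qt) = cosh((2q+1)t) + cosh((2q-1)t), the left side is
  \<open>cheb q + cheb (q - 1)\<close> at \<open>(u - v)\<^sup>2\<close>. Adding the coefficients
  produces those that occur in \<open>E\<close>.\<close>

lemma hyperbolic_even_power:
  fixes u v :: real
  assumes uv: "u * v = 1" and q: "1 \<le> q"
  shows "u ^ (2 * q) + v ^ (2 * q)
    = 2 + (\<Sum>i=1..q. real q / real i * real ((q + i - 1) choose (q - i)) * (u - v) ^ (2 * i))"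
proof -
  obtain r where r: "q = Suc r" using q by (cases q) auto
  have ne: "u + v \<noteq> 0"
  proof
    assume "u + v = 0"
    then have "v = - u" by simp
    then have "u * u = -1" using uv by simp
    then show False by (metis not_square_less_zero zero_less_one neg_less_0_iff_less)
  qed
  define a b where "a = u ^ (2 * r + 1)" and "b = v ^ (2 * r + 1)"
  have "(u + v) * cheb r ((u - v)\<^sup>2) = a + b" 
    using cheb_hyperbolic(1)[OF uv, of r] by (simp add: a_def b_def)
  moreover have "(u + v) * cheb q ((u - v)\<^sup>2) = u\<^sup>2 * a + v\<^sup>2 * b"
    using cheb_hyperbolic(1)[OF uv, of q] by (simp add: a_def b_def r power2_eq_square)
  moreover have "u ^ (2 * q) + v ^ (2 * q) = u * a + v * b"
    by (simp add: a_def b_def r)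
  moreover have "(u + v) * (u * a + v * b) = u\<^sup>2 * a + v\<^sup>2 * b + (u * v) * (a + b)"
    by (simp add: algebra_simps power2_eq_square)
  ultimately have "(u + v) * (u ^ (2 * q) + v ^ (2 * q)) = (u + v) * (cheb q ((u - v)\<^sup>2) + cheb r ((u - v)\<^sup>2))"
    by (simp add: uv distrib_left)
  then have "u ^ (2 * q) + v ^ (2 * q) = cheb q ((u - v)\<^sup>2) + cheb r ((u - v)\<^sup>2)"
    using ne by simp
  also have "cheb q ((u - v)\<^sup>2) = 1 + (\<Sum>i=1..q. real ((q + i) choose (2 * i)) * (u - v) ^ (2 * i))"
    by (simp add: cheb_def sum.atLeast_Suc_atMost power_mult)
  \<comment> \<open>The range is extended from \<open>r\<close> to \<open>q = r + 1\<close>; the new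
    term has the coefficient C(2q-1, 2q) = 0.\<close>
  also have "cheb r ((u - v)\<^sup>2) = (\<Sum>i=0..q. real ((q + i - 1) choose (2 * i)) * (u - v) ^ (2 * i))"
    by (simp add: cheb_def r power_mult binomial_eq_0)
  also have "\<dots> = 1 + (\<Sum>i=1..q. real ((q + i - 1) choose (2 * i)) * (u - v) ^ (2 * i))"
    by (simp add: sum.atLeast_Suc_atMost)
  also have "1 + (\<Sum>i=1..q. real ((q + i) choose (2 * i)) * (u - v) ^ (2 * i)) + \<dots>
      = 2 + (\<Sum>i=1..q. (real ((q + i) choose (2 * i)) + real ((q + i - 1) choose (2 * i))) * (u - v) ^ (2 * i))"
    by (simp add: sum.distrib algebra_simps)
  also have "(\<Sum>i=1..q. (real ((q + i) choose (2 * i)) + real ((q + i - 1) choose (2 * i))) * (u - v) ^ (2 * i))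
      = (\<Sum>i=1..q. real q / real i * real ((q + i - 1) choose (q - i)) * (u - v) ^ (2 * i))"
    by (rule sum.cong[OF refl], subst binomial_add_shift) auto
  finally show ?thesis .
qed

section \<open>The relation between D and E under the substitution\<close>

text \<open>Putting q = j + i - 1 and exchanging the sums collects the terms with
  \<open>d (q + 1)\<close>, so that \<open>E\<close> can be compared with \<open>D\<close> one
  coefficient at a time.\<close>

lemma E_eq:
  "E p d z = (\<Sum>q=0..p. d (q + 1) * (z ^ (2 * p) + (\<Sum>i=1..q. 2 ^ (2 * i - 1) * z ^ (2 * (p - i)) *
     (real q / real i * real ((q + i - 1) choose (q - i))))))"
proof -
  define c where "c i q = 2 ^ (2 * i - 1) * z ^ (2 * (p - i)) *
     (real q / real i * real ((q + i - 1) choose (q - i))) * d (q + 1)" for i q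
  have inner: "2 ^ (2 * i - 1) * z ^ (2 * (p - i)) *
        (\<Sum>j=1..p - i + 1. real (j + i - 1) / real i * real ((j + 2 * i - 2) choose (j - 1)) * d (j + i))
      = (\<Sum>q=i..p. c i q)" if "i \<in> {1..p}" for i
  proof -
    have "(\<Sum>q=i..p. c i q) = (\<Sum>j=1..p - i + 1. c i (j + i - 1))"
      using that by (intro sum.reindex_bij_witness[of _ "\<lambda>j. j + i - 1" "\<lambda>q. q + 1 - i"]) auto
    also have "\<dots> = (\<Sum>j=1..p - i + 1. 2 ^ (2 * i - 1) * z ^ (2 * (p - i)) *
        (real (j + i - 1) / real i * real ((j + 2 * i - 2) choose (j - 1)) * d (j + i)))"
    proof (rule sum.cong[OF refl])
      fix j assume "j \<in> {1..p - i + 1}"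
      then have "j + i - 1 + i - 1 = j + 2 * i - 2" "j + i - 1 - i = j - 1" "j + i - 1 + 1 = j + i"
        using that by auto
      then show "c i (j + i - 1) = 2 ^ (2 * i - 1) * z ^ (2 * (p - i)) *
        (real (j + i - 1) / real i * real ((j + 2 * i - 2) choose (j - 1)) * d (j + i))"
        unfolding c_def by (simp only: mult.assoc)
    qed
    finally show ?thesis by (simp only: sum_distrib_left)
  qed
  \<comment> \<open>Both sides sum over the triangle 1 \<le> i \<le> q \<le> p; q = 0 contributes an
    empty inner sum.\<close>
  have "(\<Sum>i=1..p. \<Sum>q=i..p. c i q) = (\<Sum>q=0..p. \<Sum>i=1..q. c i q)"
    by (simp add: sum.Sigma)
      (intro sum.reindex_bij_witness[of _ "\<lambda>(a,b). (b,a)" "\<lambda>(a,b). (b,a)"]; auto)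
  then have "E p d z = (\<Sum>j=1..p + 1. d j) * z ^ (2 * p) + (\<Sum>q=0..p. \<Sum>i=1..q. c i q)"
    unfolding E_def by (simp only: inner cong: sum.cong)
  also have "(\<Sum>j=1..p + 1. d j) = (\<Sum>q=0..p. d (q + 1))"
    by (intro sum.reindex_bij_witness[of _ "\<lambda>q. q + 1" "\<lambda>j. j - 1"]) auto
  finally show ?thesis
    by (simp add: c_def sum_distrib_left sum_distrib_right sum.distrib algebra_simps)
qed

text \<open>Setting q = p - k centres the exponents at 2p, which exhibits D(u)/u^(2p) as a
  combination of u^(2q) + u^(-2q).\<close>

lemma D_eq: "D p d u = (\<Sum>q=0..p. d (q + 1) * (u ^ (2 * p - 2 * q) + u ^ (2 * p + 2 * q)))"
  unfolding D_def
  by (rule sum.reindex_bij_witness[of _ "\<lambda>q. p - q" "\<lambda>q. p - q"])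
     (auto simp: Suc_diff_le diff_mult_distrib2 intro!: arg_cong2[of _ _ _ _ "(+)"] arg_cong2[of _ _ _ _ "(^)"])

lemma D_eq_E:
  fixes u z :: real
  assumes u: "u \<noteq> 0" and z: "z \<noteq> 0" and uz: "2 / z = u - 1 / u"
  shows "D p d u * z ^ (2 * p) = 2 * u ^ (2 * p) * E p d z"
proof -
  define v where "v = 1 / u"
  have uv: "u * v = 1" using u by (simp add: v_def)
  have uvz: "(u - v) * z = 2" using z uz by (simp add: v_def field_simps)
  \<comment> \<open>Twice the bracket multiplying \<open>d (q + 1)\<close> in \<open>E_eq\<close> is
    z^(2p) times 2 cosh(2qt). Since (u - v) z = 2, each (u - v)^(2i) trades 2i powers of z for
    2^(2i).\<close>
  have *: "2 * (z ^ (2 * p) + (\<Sum>i=1..q. 2 ^ (2 * i - 1) * z ^ (2 * (p - i)) *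
     (real q / real i * real ((q + i - 1) choose (q - i))))) = z ^ (2 * p) * (u ^ (2 * q) + v ^ (2 * q))"
    if "q \<le> p" for q
  proof (cases "q = 0")
    case False
    have "2 * (2 ^ (2 * i - 1) * z ^ (2 * (p - i))) = z ^ (2 * p) * (u - v) ^ (2 * i)" if "i \<in> {1..q}" for i
    proof -
      have "z ^ (2 * p) = z ^ (2 * (p - i)) * z ^ (2 * i)"
        using that \<open>q \<le> p\<close> by (simp flip: power_add distrib_left)
      then have "z ^ (2 * p) * (u - v) ^ (2 * i) = z ^ (2 * (p - i)) * ((u - v) * z) ^ (2 * i)"
        by (simp add: power_mult_distrib)
      also have "(2::real) ^ (2 * i) = 2 * 2 ^ (2 * i - 1)" using that by (simp flip: power_Suc)
      then have "z ^ (2 * (p - i)) * ((u - v) * z) ^ (2 * i) = 2 * (2 ^ (2 * i - 1) * z ^ (2 * (p - i)))"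
        by (simp add: uvz)
      finally show ?thesis by simp
    qed
    then have "(\<Sum>i=1..q. 2 * (2 ^ (2 * i - 1) * z ^ (2 * (p - i))) * (real q / real i * real ((q + i - 1) choose (q - i))))
      = (\<Sum>i=1..q. z ^ (2 * p) * (u - v) ^ (2 * i) * (real q / real i * real ((q + i - 1) choose (q - i))))"
      by (intro sum.cong) auto
    then show ?thesis
      using False by (subst hyperbolic_even_power[OF uv])
        (simp_all add: sum_distrib_left distrib_left mult.assoc mult.left_commute mult.commute)
  qed simp
  have "2 * u ^ (2 * p) * E p d z = u ^ (2 * p) * (\<Sum>q=0..p. d (q + 1) * (2 * (z ^ (2 * p) +
      (\<Sum>i=1..q. 2 ^ (2 * i - 1) * z ^ (2 * (p - i)) * (real q / real i * real ((q + i - 1) choose (q - i)))))))"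
    unfolding E_eq sum_distrib_left[of "2 * u ^ (2 * p)"] sum_distrib_left[of "u ^ (2 * p)"]
    by (rule sum.cong) (simp_all only: mult_ac)
  also have "\<dots> = u ^ (2 * p) * (\<Sum>q=0..p. d (q + 1) * (z ^ (2 * p) * (u ^ (2 * q) + v ^ (2 * q))))"
    by (rule arg_cong[where f = "(*) (u ^ (2 * p))"], rule sum.cong[OF refl], subst *) auto
  also have "\<dots> = (\<Sum>q=0..p. d (q + 1) * (u ^ (2 * p) * (u ^ (2 * q) + v ^ (2 * q)))) * z ^ (2 * p)"
    by (simp add: sum_distrib_left sum_distrib_right mult_ac)
  also have "\<dots> = D p d u * z ^ (2 * p)"
  proof -
    have "u ^ (2 * p) * (u ^ (2 * q) + v ^ (2 * q)) = u ^ (2 * p - 2 * q) + u ^ (2 * p + 2 * q)" if "q \<le> p" for q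
      using that u by (simp add: v_def power_diff power_add power_one_over field_simps)
    then show ?thesis unfolding D_eq by simp
  qed
  finally show ?thesis by simp
qed

text \<open>The map e \<mapsto> 4p - e swaps the exponents 2k and 4p - 2k.\<close>

lemma D_inverse: "u \<noteq> 0 \<Longrightarrow> D p d (1 / u) * u ^ (4 * p) = D p d u"
  unfolding D_def sum_distrib_right
  by (rule sum.cong) (auto simp: power_diff power_one_over field_simps)

section \<open>Integrability and change of variables on the half-line\<close>

text \<open>Bridge from integrals over \<open>lborel\<close> to its completion, for which the change
  of variables is formulated.\<close>

lemma set_integrable_lborel_imp_absolutely_integrable:
  fixes f :: "real \<Rightarrow> real"
  assumes "set_integrable lborel S f"
  shows "f absolutely_integrable_on S"
  using assms borel_measurable_integrable[of lborel] unfolding set_integrable_def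
  by (subst integrable_completion) auto

lemma LBINT_0_inf_eq_integral:
  fixes f :: "real \<Rightarrow> real"
  assumes "set_integrable lborel {0<..} f"
  shows "(LBINT z=0..\<infinity>. f z) = integral {0<..} f"
  using set_borel_integral_eq_integral(2)[OF assms]
  by (simp add: interval_lebesgue_integral_def zero_ereal_def)

lemma converges_0_inf_iff: "converges_0_inf f \<longleftrightarrow> set_integrable lborel {0<..} f"
  by (simp add: interval_lebesgue_integrable_def zero_ereal_def)

text \<open>Comparison with 2/(1 + z^2): F^k dominates both z^(2a) and z^(2a+2), the latter because
  2a + 2 \<le> 2qk.\<close>

lemma set_integrable_even_power_div:
  fixes F :: "real \<Rightarrow> real"
  assumes F: "F \<in> borel_measurable borel" and F1: "\<And>z. 0 < z \<Longrightarrow> 1 \<le> F z"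
    and Fq: "\<And>z. 0 < z \<Longrightarrow> z ^ (2 * q) \<le> F z" and a: "a + 1 \<le> q * k"
  shows "set_integrable lborel {0<..} (\<lambda>z. z ^ (2 * a) / F z ^ k)"
proof (rule set_integrable_bound)
  have "set_integrable lborel UNIV (\<lambda>x::real. inverse (1 + x\<^sup>2))"
    using integrable_inverse_1_plus_square by (simp add: einterval_def)
  then have "set_integrable lborel {0<..} (\<lambda>x::real. inverse (1 + x\<^sup>2))"
    by (rule set_integrable_subset) auto
  then show "set_integrable lborel {0<..} (\<lambda>z::real. 2 * inverse (1 + z\<^sup>2))"
    by simp
  show "set_borel_measurable lborel {0<..} (\<lambda>z. z ^ (2 * a) / F z ^ k)"
    unfolding set_borel_measurable_def using F by measurable
  have "z ^ (2 * a) / F z ^ k \<le> 2 * inverse (1 + z\<^sup>2)" if z: "0 < z" for z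
  proof -
    have G1: "1 \<le> F z ^ k" using F1[OF z] by (rule one_le_power)
    have "z ^ (2 * q * k) \<le> F z ^ k"
      using power_mono[OF Fq[OF z], of k] z by (simp add: power_mult)
    \<comment> \<open>For z \<le> 1 the bound comes from F \<ge> 1, for z > 1 from F \<ge>
      z^(2q).\<close>
    then have le: "z ^ l \<le> F z ^ k" if "l \<le> 2 * q * k" for l
    proof (cases "z \<le> 1")
      case True
      then have "z ^ l \<le> 1" using z by (simp add: power_le_one)
      then show ?thesis using G1 by simp
    next
      case False
      then have "z ^ l \<le> z ^ (2 * q * k)" using that by (intro power_increasing) auto
      then show ?thesis using \<open>z ^ (2 * q * k) \<le> F z ^ k\<close> by simp
    qed
    have "z ^ (2 * a) * (1 + z\<^sup>2) \<le> 2 * F z ^ k"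
      using le[of "2 * a"] le[of "2 * a + 2"] a by (simp add: power_add power2_eq_square algebra_simps)
    moreover have "0 < 1 + z\<^sup>2" by (simp add: add_pos_nonneg)
    ultimately show ?thesis using G1 by (simp add: divide_simps)
  qed
  then have "norm (z ^ (2 * a) / F z ^ k) \<le> norm (2 * inverse (1 + z\<^sup>2))" if "0 < z" for z
    using F1[OF that] that by simp
  then show "AE z in lborel. z \<in> {0<..} \<longrightarrow> norm (z ^ (2 * a) / F z ^ k) \<le> norm (2 * inverse (1 + z\<^sup>2))"
    by simp
qed

text \<open>The map u \<mapsto> 2u/(u^2 - 1) is a bijection from u > 1 onto z > 0; the weight is the
  absolute value of its negative derivative.\<close>

lemma integral_substitution:
  fixes G :: "real \<Rightarrow> real"
  assumes "G absolutely_integrable_on {0<..}"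
  shows "integral {0<..} G = integral {1<..} (\<lambda>u. 2 * (u\<^sup>2 + 1) / (u\<^sup>2 - 1)\<^sup>2 * G (2 * u / (u\<^sup>2 - 1)))"
proof -
  define g where "g u = 2 * u / (u\<^sup>2 - 1)" for u :: real
  have u2: "u\<^sup>2 > 1" if "u > 1" for u :: real using that by (simp add: one_less_power)
  have image: "g ` {1<..} = {0<..}"
  proof (intro set_eqI iffI)
    fix z assume "z \<in> g ` {1<..}"
    then show "z \<in> {0<..}" using u2 by (auto simp: g_def)
  next
    fix z :: real assume "z \<in> {0<..}"
    then have z: "z > 0" by simp
    \<comment> \<open>The preimage (1 + t)/z is the larger root of z u^2 - 2u - z = 0.\<close>
    define t where "t = sqrt (1 + z\<^sup>2)"
    have t: "t\<^sup>2 = 1 + z\<^sup>2" "t > 0" "t > z"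
      using z by (auto simp: t_def add_pos_nonneg intro!: real_less_rsqrt)
    have "((1 + t) / z)\<^sup>2 - 1 = 2 * (1 + t) / z\<^sup>2"
      using z t(1) by (simp add: field_simps power2_eq_square)
    then have "g ((1 + t) / z) = z"
      using z t(2) by (simp add: g_def power2_eq_square divide_simps)
    moreover have "(1 + t) / z > 1" using z t by (simp add: field_simps)
    ultimately show "z \<in> g ` {1<..}" by (metis greaterThan_iff image_eqI)
  qed
  have inj: "inj_on g {1<..}"
  proof (rule inj_onI)
    fix x y :: real assume xy: "x \<in> {1<..}" "y \<in> {1<..}" and "g x = g y"
    then have "(2 * x) / (x\<^sup>2 - 1) = (2 * y) / (y\<^sup>2 - 1)" by (simp only: g_def)
    then have "2 * x * (y\<^sup>2 - 1) = 2 * y * (x\<^sup>2 - 1)"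
      
      using frac_eq_eq[of "x\<^sup>2 - 1" "y\<^sup>2 - 1" "2 * x" "2 * y"] u2[of x] u2[of y] xy
      by (metis eq_iff_diff_eq_0 greaterThan_iff less_irrefl)
    then have "(y - x) * (x * y + 1) = 0" by algebra
    moreover have "x * y + 1 > 0" using xy by (simp add: add_pos_pos)
    ultimately show "x = y" by simp
  qed
  have deriv: "(g has_field_derivative - (2 * (u\<^sup>2 + 1) / (u\<^sup>2 - 1)\<^sup>2)) (at u within {1<..})" if "u \<in> {1<..}" for u
  proof (rule DERIV_cong)
    show "(g has_field_derivative (2 * (u\<^sup>2 - 1) - 2 * u * (2 * u)) / (u\<^sup>2 - 1)\<^sup>2) (at u within {1<..})"
      unfolding g_def[abs_def] using u2[of u] that
      by (auto intro!: derivative_eq_intros simp: power2_eq_square)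
    have "2 * (u\<^sup>2 - 1) - 2 * u * (2 * u) = - (2 * (u\<^sup>2 + 1))"
      by (simp add: algebra_simps power2_eq_square)
    then show "(2 * (u\<^sup>2 - 1) - 2 * u * (2 * u)) / (u\<^sup>2 - 1)\<^sup>2 = - (2 * (u\<^sup>2 + 1) / (u\<^sup>2 - 1)\<^sup>2)"
      by (simp only: minus_divide_left)
  qed
  have "integral {1<..} (\<lambda>u. \<bar>- (2 * (u\<^sup>2 + 1) / (u\<^sup>2 - 1)\<^sup>2)\<bar> * G (g u)) = integral {0<..} G"
    using has_absolute_integral_change_of_variables_1'[OF _ deriv inj, of G "integral {0<..} G"] assms
    by (simp add: image)
  then show ?thesis by (simp add: g_def)
qed

lemma D_measurable [measurable]: "D p d \<in> borel_measurable borel"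
  unfolding D_def[abs_def] by measurable

lemma E_measurable [measurable]: "E p d \<in> borel_measurable borel"
  unfolding E_def[abs_def] by measurable

section \<open>Lower bounds and convergence for positive coefficients\<close>

locale palindromic_family =
  fixes m p :: nat and d :: "nat \<Rightarrow> real"
  assumes p: "p \<ge> 1" and d_pos: "\<And>i. 1 \<le> i \<Longrightarrow> i \<le> p \<Longrightarrow> d i > 0" and d_last: "d (p + 1) = 1"
begin

lemma d_nonneg: "1 \<le> i \<Longrightarrow> i \<le> p + 1 \<Longrightarrow> d i \<ge> 0"
  using d_pos[of i] d_last by (cases "i = p + 1") auto

text \<open>All terms are nonnegative, and the one for k = 0 is 1 + z^(4p) because
  \<open>d (p + 1) = 1\<close>.\<close>

lemma D_ge:
  assumes "z > 0"
  shows "1 \<le> D p d z" and "z ^ (4 * p) \<le> D p d z"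
proof -
  have "d (p + 1 - 0) * (z ^ (2 * 0) + z ^ (4 * p - 2 * 0)) \<le> D p d z"
    unfolding D_def using assms d_nonneg by (intro member_le_sum) auto
  then have "1 + z ^ (4 * p) \<le> D p d z" using d_last by simp
  then show "1 \<le> D p d z" and "z ^ (4 * p) \<le> D p d z"
    using zero_less_power[OF assms, of "4 * p"] by linarith+
qed

text \<open>Two nonnegative parts suffice: the coefficient of z^(2p) is at least
  \<open>d (p + 1) = 1\<close>, and the constant term, from i = p and j = 1, is 2^(2p-1) \<ge>
  1.\<close>

lemma E_ge:
  assumes "z > 0"
  shows "1 \<le> E p d z" and "z ^ (2 * p) \<le> E p d z"
proof -
  define c where "c i j = real (j + i - 1) / real i * real ((j + 2 * i - 2) choose (j - 1)) * d (j + i)" for i j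
  have E: "E p d z = (\<Sum>j=1..p + 1. d j) * z ^ (2 * p) +
     (\<Sum>i=1..p. 2 ^ (2 * i - 1) * z ^ (2 * (p - i)) * (\<Sum>j=1..p - i + 1. c i j))"
    by (simp only: E_def c_def)
  have c: "c i j \<ge> 0" if "i \<in> {1..p}" "j \<in> {1..p - i + 1}" for i j
    unfolding c_def using that by (intro mult_nonneg_nonneg d_nonneg) auto
  have "d (p + 1) \<le> (\<Sum>j=1..p + 1. d j)"
    using d_nonneg by (intro member_le_sum) auto
  then have first: "z ^ (2 * p) \<le> (\<Sum>j=1..p + 1. d j) * z ^ (2 * p)"
    using assms d_last by simp
  have "2 ^ (2 * p - 1) * z ^ (2 * (p - p)) * (\<Sum>j=1..p - p + 1. c p j) \<le>
     (\<Sum>i=1..p. 2 ^ (2 * i - 1) * z ^ (2 * (p - i)) * (\<Sum>j=1..p - i + 1. c i j))"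
    using p assms
    by (intro member_le_sum[where f = "\<lambda>i. 2 ^ (2 * i - 1) * z ^ (2 * (p - i)) * (\<Sum>j=1..p - i + 1. c i j)"]
        mult_nonneg_nonneg sum_nonneg c) auto
  also have "2 ^ (2 * p - 1) * z ^ (2 * (p - p)) * (\<Sum>j=1..p - p + 1. c p j) = 2 ^ (2 * p - 1)"
    using p d_last by (simp add: c_def)
  finally have second: "1 \<le> (\<Sum>i=1..p. 2 ^ (2 * i - 1) * z ^ (2 * (p - i)) * (\<Sum>j=1..p - i + 1. c i j))"
    using one_le_power[of "2::real" "2 * p - 1"] by linarith
  show "1 \<le> E p d z" and "z ^ (2 * p) \<le> E p d z"
    unfolding E using first second zero_less_power[OF assms, of "2 * p"] by linarith+
qed

lemma set_integrable_N_integrand: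
  assumes "n + 1 \<le> 2 * p * (m + 1)"
  shows "set_integrable lborel {0<..} (N_integrand m p d n)"
  unfolding N_integrand_def[abs_def] using D_ge assms
  by (intro set_integrable_even_power_div[where q = "2 * p"]) auto

lemma set_integrable_E_integrand:
  "set_integrable lborel {0<..} (E_integrand m p d j)"
  unfolding E_integrand_def[abs_def] using E_ge p
  by (intro set_integrable_even_power_div[where q = p]) (auto simp: mult.commute)

section \<open>Folding onto u > 1 and the two integral identities\<close>

text \<open>The inversion u \<mapsto> 1/u carries the part over (0,1) to u > 1 and changes
  \<open>n\<close> into \<open>n'\<close>. The resulting integrand is symmetric in \<open>n\<close>
  and \<open>n'\<close>.\<close>

lemma N_eq_integral_Ioi_1:
  assumes n: "n + 1 \<le> 2 * p * (m + 1)"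
  defines "n' \<equiv> 2 * p * (m + 1) - 1 - n"
  shows "N m p d n = integral {1<..} (\<lambda>u. N_integrand m p d n u + N_integrand m p d n' u)"
proof -
  let ?f = "N_integrand m p d"
  have int: "set_integrable lborel {0<..} (?f n)" "set_integrable lborel {0<..} (?f n')"
    using n by (auto intro!: set_integrable_N_integrand simp: n'_def)
  have abs: "?f n absolutely_integrable_on S" "?f n' absolutely_integrable_on S"
    if "S \<subseteq> {0<..}" "S \<in> sets borel" for S
    using that int by (auto intro!: set_integrable_lborel_imp_absolutely_integrable intro: set_integrable_subset)
  have image: "(\<lambda>u::real. 1 / u) ` {1<..} = {0<..<1}"
  proof (intro set_eqI iffI)
    fix x :: real assume "x \<in> {0<..<1}"
    then show "x \<in> (\<lambda>u. 1 / u) ` {1<..}"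
      by (intro image_eqI[of _ _ "1 / x"]) (auto simp: field_simps)
  qed (auto simp: field_simps)
  have deriv: "((\<lambda>u. 1 / u) has_field_derivative - 1 / x\<^sup>2) (at x within {1<..})" if "x \<in> {1<..}" for x :: real
    using that by (auto intro!: derivative_eq_intros simp: power2_eq_square)
  have inj: "inj_on (\<lambda>u::real. 1 / u) {1<..}" by (auto simp: inj_on_def)
  have "integral {0<..<1} (?f n) = integral {1<..} (\<lambda>u. \<bar>- 1 / u\<^sup>2\<bar> * ?f n (1 / u))"
    using has_absolute_integral_change_of_variables_1'[OF _ deriv inj, of "?f n" "integral {0<..<1} (?f n)"]
    using abs(1)[of "{0<..<1}"] by (simp add: image subset_iff)
  also have "integral {1<..} (\<lambda>u. \<bar>- 1 / u\<^sup>2\<bar> * ?f n (1 / u)) = integral {1<..} (?f n')"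
  proof (rule integral_cong)
    fix u :: real assume "u \<in> {1<..}"
    then have u: "u > 0" by simp
    have "D p d u > 0" "D p d (1 / u) > 0" using D_ge(1)[OF u] D_ge(1)[of "1 / u"] u by auto
    have eq: "D p d u ^ (m + 1) = D p d (1 / u) ^ (m + 1) * u ^ (4 * p * (m + 1))"
      using u D_inverse[of u p d] by (simp only: power_mult flip: power_mult_distrib)
    \<comment> \<open>This balance fixes \<open>n'\<close>: the palindromic factor u^(4p(m+1))
      absorbs u^(-2n) from the numerator and u^(-2) from the derivative, leaving u^(2n').\<close>
    have "4 * p * (m + 1) = 2 * n' + 2 * n + 2" using n by (simp add: n'_def)
    then have "u ^ (4 * p * (m + 1)) = u ^ (2 * n') * u ^ (2 * n) * u\<^sup>2" by (simp only: power_add)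
    with eq have "D p d u ^ (m + 1) = D p d (1 / u) ^ (m + 1) * (u ^ (2 * n') * u ^ (2 * n) * u\<^sup>2)" by simp
    then show "\<bar>- 1 / u\<^sup>2\<bar> * ?f n (1 / u) = ?f n' u"
      using u \<open>D p d (1 / u) > 0\<close> unfolding N_integrand_def by (simp add: power_one_over)
  qed
  finally have sub: "integral {0<..<1} (?f n) = integral {1<..} (?f n')" .
  have "N m p d n = integral {0<..} (?f n)"
    unfolding N_def by (rule LBINT_0_inf_eq_integral[OF int(1)])
  also have "\<dots> = integral ({0<..<1} \<union> {1<..}) (?f n)"
    by (rule integral_spike_set; rule negligible_subset[of "{1}"]) auto
  also have "\<dots> = integral {0<..<1} (?f n) + integral {1<..} (?f n)"
    by (intro integral_Un set_lebesgue_integral_eq_integral(1) abs) (auto intro: negligible_subset[OF negligible_empty])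
  also have "\<dots> = integral {1<..} (\<lambda>u. ?f n u + ?f n' u)"
    unfolding sub by (subst integral_add) (auto intro!: set_lebesgue_integral_eq_integral(1) abs)
  finally show ?thesis .
qed

text \<open>Pointwise form of the main identity. The derivative of the substitution supplies the
  factor u + v that \<open>cheb r\<close> lacks to become u^(2r+1) + v^(2r+1).\<close>

lemma N_integrand_substitution:
  fixes u :: real
  assumes u: "u > 1" and n: "n + 1 \<le> (m + 1) * p"
  defines "z \<equiv> 2 * u / (u\<^sup>2 - 1)" and "r \<equiv> (m + 1) * p - n - 1"
  shows "2 * (u\<^sup>2 + 1) / (u\<^sup>2 - 1)\<^sup>2 *
      (\<Sum>j=0..r. 4 ^ j * real ((r + j) choose (2 * j)) * E_integrand m p d j z)
    = 2 ^ m * (N_integrand m p d n u + N_integrand m p d (2 * p * (m + 1) - 1 - n) u)"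
proof -
  define v where "v = 1 / u"
  have uv: "u * v = 1" using u by (simp add: v_def)
  have u2: "u\<^sup>2 > 1" using u by (simp add: one_less_power)
  have z: "z > 0" using u u2 by (simp add: z_def)
  have uz: "2 / z = u - 1 / u" using u u2 by (simp add: z_def field_simps power2_eq_square)
  have Dpos: "D p d u > 0" and Epos: "E p d z > 0" using D_ge(1)[of u] E_ge(1)[OF z] u by auto
  have DE: "z ^ (2 * p) / E p d z = 2 * u ^ (2 * p) / D p d u"
    using D_eq_E[of u z p d] z u uz Dpos Epos by (simp add: field_simps)
  \<comment> \<open>The numerator of \<open>E_integrand\<close> is z^(2p(m+1)) / z^(2j+2). Here 4^j
    / z^(2j) = (u - v)^(2j), and 1/z^2 is kept for the weight.\<close>
  have summand: "4 ^ j * E_integrand m p d j z = ((u - v)\<^sup>2) ^ j * (1 / z\<^sup>2 * (2 * u ^ (2 * p) / D p d u) ^ (m + 1))"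
    if "j \<le> r" for j
  proof -
    have "2 * ((m + 1) * p - 1 - j) + 2 * j + 2 = 2 * p * (m + 1)"
      using that n p by (simp add: r_def algebra_simps)
    then have "z ^ (2 * p * (m + 1)) = z ^ (2 * ((m + 1) * p - 1 - j)) * z ^ (2 * j) * z\<^sup>2"
      by (metis power_add)
    then have "E_integrand m p d j z = (z ^ (2 * p) / E p d z) ^ (m + 1) / (z ^ (2 * j) * z\<^sup>2)"
      using z by (simp only: E_integrand_def power_divide flip: power_mult) simp
    moreover have "4 ^ j / z ^ (2 * j) = ((u - v)\<^sup>2) ^ j"
      unfolding v_def uz[symmetric] by (simp add: power_divide power_mult)
    moreover have "4 ^ j * ((z ^ (2 * p) / E p d z) ^ (m + 1) / (z ^ (2 * j) * z\<^sup>2))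
        = (4 ^ j / z ^ (2 * j)) * (1 / z\<^sup>2 * (z ^ (2 * p) / E p d z) ^ (m + 1))"
      by simp
    ultimately show ?thesis unfolding DE by simp
  qed
  have "(\<Sum>j=0..r. 4 ^ j * real ((r + j) choose (2 * j)) * E_integrand m p d j z)
      = (\<Sum>j=0..r. real ((r + j) choose (2 * j)) * (4 ^ j * E_integrand m p d j z))"
    by (simp add: mult_ac)
  also have "\<dots> = (\<Sum>j=0..r. real ((r + j) choose (2 * j)) * ((u - v)\<^sup>2) ^ j * (1 / z\<^sup>2 * (2 * u ^ (2 * p) / D p d u) ^ (m + 1)))"
    by (rule sum.cong[OF refl], subst summand) (auto simp only: mult.assoc atLeastAtMost_iff)
  also have "\<dots> = cheb r ((u - v)\<^sup>2) * (1 / z\<^sup>2 * (2 * u ^ (2 * p) / D p d u) ^ (m + 1))"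
    unfolding cheb_def sum_distrib_right ..
  finally have sum: "(\<Sum>j=0..r. 4 ^ j * real ((r + j) choose (2 * j)) * E_integrand m p d j z)
      = cheb r ((u - v)\<^sup>2) * (1 / z\<^sup>2 * (2 * u ^ (2 * p) / D p d u) ^ (m + 1))" .
  have "1 / z\<^sup>2 = (u\<^sup>2 - 1)\<^sup>2 * v\<^sup>2 / 4"
    by (simp add: z_def v_def power_divide power_mult_distrib)
  then have "2 * (u\<^sup>2 + 1) / (u\<^sup>2 - 1)\<^sup>2 * (1 / z\<^sup>2) = (u\<^sup>2 + 1) * v\<^sup>2 / 2"
    using u2 by (simp only:) simp
  also have "(u\<^sup>2 + 1) * v\<^sup>2 = (u + v) * v"
    using uv by algebra
  finally have weight: "2 * (u\<^sup>2 + 1) / (u\<^sup>2 - 1)\<^sup>2 * (1 / z\<^sup>2) = (u + v) * v / 2" .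
  have "K * (C * (W * X)) = (K * W) * C * X" for K C W X :: real
    by simp
  then have "2 * (u\<^sup>2 + 1) / (u\<^sup>2 - 1)\<^sup>2 *
      (cheb r ((u - v)\<^sup>2) * (1 / z\<^sup>2 * (2 * u ^ (2 * p) / D p d u) ^ (m + 1)))
    = (u + v) * v / 2 * cheb r ((u - v)\<^sup>2) * (2 * u ^ (2 * p) / D p d u) ^ (m + 1)"
    unfolding weight[symmetric] .
  also have "\<dots> = ((u + v) * cheb r ((u - v)\<^sup>2)) * v / 2 * (2 * u ^ (2 * p) / D p d u) ^ (m + 1)"
    by simp
  also have "(u + v) * cheb r ((u - v)\<^sup>2) = u ^ (2 * r + 1) + v ^ (2 * r + 1)"
    by (rule cheb_hyperbolic(1)[OF uv])
  \<comment> \<open>The factor 2^(m+1) from \<open>DE\<close> and the 1/2 from \<open>weight\<close>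
    leave 2^m.\<close>
  also have "(u ^ (2 * r + 1) + v ^ (2 * r + 1)) * v / 2 * (2 * u ^ (2 * p) / D p d u) ^ (m + 1)
    = 2 ^ m * ((u ^ (2 * r + 1) + v ^ (2 * r + 1)) * v * u ^ (2 * p * (m + 1))) / D p d u ^ (m + 1)"
  proof -
    have "(2 * u ^ (2 * p) / D p d u) ^ (m + 1) = 2 ^ (m + 1) * u ^ (2 * p * (m + 1)) / D p d u ^ (m + 1)"
      by (simp only: power_divide power_mult_distrib power_mult[of u "2 * p"])
    then show ?thesis by simp
  qed
  also have "(u ^ (2 * r + 1) + v ^ (2 * r + 1)) * v * u ^ (2 * p * (m + 1))
    = u ^ (2 * n) + u ^ (2 * (2 * p * (m + 1) - 1 - n))"
  proof -
    define e where "e = 2 * p * (m + 1)"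
    \<comment> \<open>By this count v^(2r+2) u^e = u^(2n), while u^(2r+1) v u^e = u^(2(e-1-n));
      these are the two folded numerators.\<close>
    have e: "e = 2 * n + 2 * r + 2" using n by (simp add: e_def r_def algebra_simps)
    have e': "2 * (e - 1 - n) = 2 * r + 1 + (2 * r + 1) + 2 * n" using e by simp
    have a: "u ^ e = u ^ (2 * r + 1) * u * u ^ (2 * n)" unfolding e by (simp add: power_add)
    have b: "u ^ (2 * (e - 1 - n)) = u ^ (2 * r + 1) * u ^ (2 * r + 1) * u ^ (2 * n)"
      unfolding e' by (simp only: power_add)
    have shuffle: "(x + y) * v * (x * u * w) = (u * v) * (y * x * w + x * x * w)" for x y w
      by (simp add: algebra_simps)
    have "v ^ (2 * r + 1) * u ^ (2 * r + 1) = 1" using uv by (simp only: mult.commute flip: power_mult_distrib) simp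
    then have "(u ^ (2 * r + 1) + v ^ (2 * r + 1)) * v * u ^ e = u ^ (2 * n) + u ^ (2 * (e - 1 - n))"
      using shuffle[of "u ^ (2 * r + 1)" "v ^ (2 * r + 1)" "u ^ (2 * n)"] uv
      unfolding a b by (simp only:) simp
    then show ?thesis by (simp only: e_def)
  qed
  finally show ?thesis
    unfolding sum by (simp add: N_integrand_def add_divide_distrib distrib_left)
qed

text \<open>The substitution is applied once, to the finite combination \<open>G\<close>; the
  pointwise identity then gives 2^m times the folded form of \<open>N\<close>.\<close>

lemma N_eq_sum:
  assumes n: "n + 1 \<le> (m + 1) * p"
  defines "r \<equiv> (m + 1) * p - n - 1"
  shows "N m p d n = 1 / 2 ^ m *
    (\<Sum>j=0..r. 4 ^ j * real ((r + j) choose (2 * j)) * (LBINT z=0..\<infinity>. E_integrand m p d j z))"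
proof -
  define G where "G z = (\<Sum>j=0..r. 4 ^ j * real ((r + j) choose (2 * j)) * E_integrand m p d j z)" for z
  have E: "E_integrand m p d j absolutely_integrable_on {0<..}" for j
    by (intro set_integrable_lborel_imp_absolutely_integrable set_integrable_E_integrand)
  have G: "G absolutely_integrable_on {0<..}"
    unfolding G_def[abs_def] by (intro absolutely_integrable_sum set_integrable_mult_right E) auto
  have "(\<Sum>j=0..r. 4 ^ j * real ((r + j) choose (2 * j)) * (LBINT z=0..\<infinity>. E_integrand m p d j z))
      = integral {0<..} G"
    unfolding G_def[abs_def] LBINT_0_inf_eq_integral[OF set_integrable_E_integrand]
    by (subst integral_sum) (auto intro!: integrable_on_mult_right set_lebesgue_integral_eq_integral(1) E)
  also have "\<dots> = integral {1<..} (\<lambda>u. 2 ^ m * (N_integrand m p d n u + N_integrand m p d (2 * p * (m + 1) - 1 - n) u))"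
    unfolding integral_substitution[OF G]
    using N_integrand_substitution[OF _ n] by (intro integral_cong) (simp add: G_def r_def)
  also have "\<dots> = 2 ^ m * N m p d n"
  proof -
    have "n + 1 \<le> 2 * p * (m + 1)" using n by (simp add: algebra_simps)
    from N_eq_integral_Ioi_1[OF this] show ?thesis by simp
  qed
  finally show ?thesis by simp
qed

text \<open>Under the bound, n \<mapsto> 2p(m+1) - 1 - n is an involution, so both sides fold to the
  same integral with its summands swapped.\<close>

lemma N_symmetric:
  assumes "n + 1 \<le> 2 * p * (m + 1)"
  shows "N m p d n = N m p d (2 * p * (m + 1) - 1 - n)"
  using N_eq_integral_Ioi_1[of n] N_eq_integral_Ioi_1[of "2 * p * (m + 1) - 1 - n"] assms
  by (simp add: add.commute)

end

theorem theorem2p1: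
  fixes m n p :: nat and d :: "nat \<Rightarrow> real"
  assumes "p \<ge> 1"
    and "\<And>i. 1 \<le> i \<Longrightarrow> i \<le> p \<Longrightarrow> d i > 0"
    and "d (p + 1) = 1"
  shows
    "(n \<le> (m + 1) * p - 1 \<longrightarrow>
        converges_0_inf (N_integrand m p d n) \<and>
        (\<forall>j \<le> (m + 1) * p - n - 1. converges_0_inf (E_integrand m p d j)) \<and>
        N m p d n =
          1 / 2 ^ m *
          (\<Sum>j=0..(m + 1) * p - n - 1.
             4 ^ j * real (((m + 1) * p - n - 1 + j) choose (2 * j)) *
             (LBINT z=0..\<infinity>. E_integrand m p d j z)))
     \<and>
     ((m + 1) * p - 1 < n \<and> n < 2 * p * (m + 1) - 1 \<longrightarrow>
        converges_0_inf (N_integrand m p d n) \<and>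
        converges_0_inf (N_integrand m p d (2 * p * (m + 1) - 1 - n)) \<and>
        N m p d n = N m p d (2 * p * (m + 1) - 1 - n))"
proof -
  interpret palindromic_family m p d using assms by unfold_locales
  \<comment> \<open>Makes \<open>(m + 1) * p - 1\<close> an exact subtraction, so that
    \<open>n \<le> (m + 1) * p - 1\<close> yields \<open>n + 1 \<le> (m + 1) * p\<close>.\<close>
  have pos: "(m + 1) * p \<ge> 1" using assms(1) by simp
  have N_int: "converges_0_inf (N_integrand m p d k)" if "k + 1 \<le> 2 * p * (m + 1)" for k
    unfolding converges_0_inf_iff by (rule set_integrable_N_integrand[OF that])
  show ?thesis
  proof (intro conjI impI)
    assume "n \<le> (m + 1) * p - 1"
    then have n: "n + 1 \<le> (m + 1) * p" using pos by linarith
    then show "converges_0_inf (N_integrand m p d n)" by (intro N_int) (simp add: algebra_simps)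
    show "\<forall>j \<le> (m + 1) * p - n - 1. converges_0_inf (E_integrand m p d j)"
      unfolding converges_0_inf_iff using set_integrable_E_integrand by blast
    show "N m p d n = 1 / 2 ^ m *
          (\<Sum>j=0..(m + 1) * p - n - 1.
             4 ^ j * real (((m + 1) * p - n - 1 + j) choose (2 * j)) *
             (LBINT z=0..\<infinity>. E_integrand m p d j z))"
      by (rule N_eq_sum[OF n])
  next
    assume "(m + 1) * p - 1 < n \<and> n < 2 * p * (m + 1) - 1"
    then have n: "n + 1 \<le> 2 * p * (m + 1)" by linarith
    show "converges_0_inf (N_integrand m p d n)" using n by (rule N_int)
    show "converges_0_inf (N_integrand m p d (2 * p * (m + 1) - 1 - n))"
      using n by (intro N_int) linarith
    show "N m p d n = N m p d (2 * p * (m + 1) - 1 - n)" using n by (rule N_symmetric)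
  qed
qed

end
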